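(* Consider an extremal of the time-optimal control problem for the car-like robot with one trailer, with adjoint constants $c_1,c_2,c_3,c_4$, and let $\ell$ denote the line $c_1y-c_2x+c_3=0$ in the plane. Consider a $\phi_\omega$-singular primitive of this extremal over the time interval $[t_0,t_1]$ that contains a straight line segment. Then: (1) All of the straight line segments of the primitive lie on $\ell$. (2) Either $c_4=0$ and the entire primitive is a straight line, i.e. on $[t_0,t_1]$ $$\alpha\equiv 0\ \text{or}\ \pi,\qquad \omega\equiv 0,\qquad \lambda_\beta\equiv\lambda_\theta\equiv 0,$$ or, for all $t\in[t_0,t_1]$, $$\alpha(t)=\pm2\beta(t),\qquad \omega(t)=d(t)=\pm2\sin\beta(t),$$ $$-\frac{\pi}{6}\le\beta(t)\le\frac{\pi}{6}\quad\text{or}\quad \frac{5\pi}{6}\le\beta(t)\le\frac{7\pi}{6}.$$ Here $d$ is the signed distance from the center $(x,y)$ of the robot to $\ell$, and $\alpha$ is the angle between the robot orientation and $\ell$.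
   Context: System: configurations $q=(x,y,\theta,\beta)\in\mathbb{R}^2\times S^1\times S^1$ and controls $u=(v,\omega)\in U=[-1,1]^2$, with $$\dot x = v\cos\theta,\quad \dot y = v\sin\theta,\quad \dot\theta=\omega,\quad \dot\beta=-v\sin\beta+\omega.$$ Here $(x,y)$ is the center of the robot, $\theta$ its orientation, and $\beta$ the angle between trailer and robot. The problem is to minimize the time $T$ of a trajectory on $[0,T]$ joining two given configurations. Hamiltonian: for $\lambda=(\lambda_x,\lambda_y,\lambda_\theta,\lambda_\beta)$, $$H(q,\lambda,u)= v(\lambda_x\cos\theta+\lambda_y\sin\theta-\lambda_\beta\sin\beta)+\omega(\lambda_\theta+\lambda_\beta).$$ Extremal: a trajectory-control pair $(q(t),u(t))$ on $[0,T]$ together with an absolutely continuous adjoint $\lambda(t)\neq 0$ satisfying the Pontryagin Maximum Principle, i.e. $$\dot\lambda_x=0,\quad \dot\lambda_y=0,\quad \dot\lambda_\theta=v(\lambda_x\sin\theta-\lambda_y\cos\theta),\quad \dot\lambda_\beta=v\lambda_\beta\cos\beta,$$ and $H(q(t),\lambda(t),u(t))=\max_{z\in U}H(q(t),\lambda(t),z)$ for all $t\in[0,T]$. Adjoint constants: integrating the adjoint equations gives constants $c_1,c_2,c_3,c_4$ with $\lambda_x=c_1$, $\lambda_y=c_2$, $\lambda_\theta=c_1y-c_2x+c_3$, $\lambda_\beta(t)=c_4\exp\left(\int_0^t v\cos\beta(\tau)\,d\tau\right)$, so $c_4=\lambda_\beta(0)$. Switching functions: $\phi_v=\lambda_x\cos\theta+\lambda_y\sin\theta-\lambda_\beta\sin\beta$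 and $\phi_\omega=\lambda_\theta+\lambda_\beta$. The maximization condition means $v\phi_v=|\phi_v|$ and $\omega\phi_\omega=|\phi_\omega|$. $\phi_\omega$-singular primitive: a piece of an extremal over an interval $[t_0,t_1]\subset[0,T]$ of positive length, along which $\phi_\omega\equiv 0$ but not both $\phi_v\equiv0$ and $\phi_\omega\equiv 0$. Along such a primitive $\phi_v$ is a nonzero constant, $v=\mathrm{sgn}(\phi_v)$, and the control is $\omega=\lambda_\theta/|\phi_v|$. Straight line segment: a piece of the trajectory over a time interval of positive length with $v=\pm1$ and $\omega=0$. Signed distance: $d=\dfrac{c_1y-c_2x+c_3}{\|(c_1,c_2)\|}$. Angle: $\alpha$ is the angle between the orientation vector $(\cos\theta,\sin\theta)$ and the direction $(c_1,c_2)$ of $\ell$. Angles are taken modulo $2\pi$, and $\pm$ means that the equality holds for one of the two choices of sign. *)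

theory Defs
  imports "HOL-Analysis.Analysis" "HOL-Library.Real_Mod"
begin

(* Angles are represented by real numbers; a trajectory in the circle is represented by
   a continuous real lift, and equality of angles is congruence modulo 2 * pi. *)

type_synonym config = "real \<times> real \<times> real \<times> real"   (* (x, y, theta, beta) *)
type_synonym costate = "real \<times> real \<times> real \<times> real"  (* dual to (x, y, theta, beta) *)
type_synonym control = "real \<times> real"                   (* (v, omega) *)

definition control_set :: "control set" where
  "control_set = {-1..1} \<times> {-1..1}"

fun hamiltonian :: "config \<Rightarrow> costate \<Rightarrow> control \<Rightarrow> real" where
  "hamiltonian (x, y, \<theta>, \<beta>) (l\<^sub>x, l\<^sub>y, l\<^sub>\<theta>, l\<^sub>\<beta>) (v, \<omega>) =
     v * (l\<^sub>x * cos \<theta> + l\<^sub>y * sin \<theta> - l\<^sub>\<beta> * sin \<beta>) + \<omega> * (l\<^sub>\<theta> + l\<^sub>\<beta>)"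

fun phi_v :: "config \<Rightarrow> costate \<Rightarrow> real" where
  "phi_v (x, y, \<theta>, \<beta>) (l\<^sub>x, l\<^sub>y, l\<^sub>\<theta>, l\<^sub>\<beta>) = l\<^sub>x * cos \<theta> + l\<^sub>y * sin \<theta> - l\<^sub>\<beta> * sin \<beta>"

fun phi_omega :: "config \<Rightarrow> costate \<Rightarrow> real" where
  "phi_omega (x, y, \<theta>, \<beta>) (l\<^sub>x, l\<^sub>y, l\<^sub>\<theta>, l\<^sub>\<beta>) = l\<^sub>\<theta> + l\<^sub>\<beta>"

(* Absolute continuity on [a, b]. D ranges over the finite families of
   non-overlapping closed intervals K = [Inf K, Sup K] contained in [a, b]. *)
definition abs_continuous_on :: "real \<Rightarrow> real \<Rightarrow> (real \<Rightarrow> real) \<Rightarrow> bool" where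
  "abs_continuous_on a b f \<longleftrightarrow>
     (\<forall>\<epsilon>>0. \<exists>\<delta>>0. \<forall>D. D division_of (\<Union>D) \<and> \<Union>D \<subseteq> {a..b} \<and> (\<Sum>K\<in>D. Sup K - Inf K) < \<delta>
        \<longrightarrow> (\<Sum>K\<in>D. \<bar>f (Sup K) - f (Inf K)\<bar>) < \<epsilon>)"

(* Absolutely continuous (Caratheodory) solution of f' = g: controls are merely
   measurable, so the equation is required for almost every t. *)
definition solves_ae :: "real \<Rightarrow> (real \<Rightarrow> real) \<Rightarrow> (real \<Rightarrow> real) \<Rightarrow> bool" where
  "solves_ae T f g \<longleftrightarrow> abs_continuous_on 0 T f \<and>
     (AE t\<in>{0..T} in lebesgue. (f has_real_derivative g t) (at t within {0..T}))"

definition trajectory ::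
  "real \<Rightarrow> (real \<Rightarrow> real) \<Rightarrow> (real \<Rightarrow> real) \<Rightarrow> (real \<Rightarrow> real) \<Rightarrow> (real \<Rightarrow> real) \<Rightarrow>
   (real \<Rightarrow> real) \<Rightarrow> (real \<Rightarrow> real) \<Rightarrow> bool" where
  "trajectory T x y \<theta> \<beta> v \<omega> \<longleftrightarrow>
     v \<in> borel_measurable (lebesgue_on {0..T}) \<and> \<omega> \<in> borel_measurable (lebesgue_on {0..T}) \<and>
     (\<forall>t\<in>{0..T}. (v t, \<omega> t) \<in> control_set) \<and>
     solves_ae T x (\<lambda>t. v t * cos (\<theta> t)) \<and>
     solves_ae T y (\<lambda>t. v t * sin (\<theta> t)) \<and>
     solves_ae T \<theta> \<omega> \<and>
     solves_ae T \<beta> (\<lambda>t. - v t * sin (\<beta> t) + \<omega> t)"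

definition extremal ::
  "real \<Rightarrow> (real \<Rightarrow> real) \<Rightarrow> (real \<Rightarrow> real) \<Rightarrow> (real \<Rightarrow> real) \<Rightarrow> (real \<Rightarrow> real) \<Rightarrow>
   (real \<Rightarrow> real) \<Rightarrow> (real \<Rightarrow> real) \<Rightarrow>
   (real \<Rightarrow> real) \<Rightarrow> (real \<Rightarrow> real) \<Rightarrow> (real \<Rightarrow> real) \<Rightarrow> (real \<Rightarrow> real) \<Rightarrow> bool" where
  "extremal T x y \<theta> \<beta> v \<omega> l\<^sub>x l\<^sub>y l\<^sub>\<theta> l\<^sub>\<beta> \<longleftrightarrow>
     trajectory T x y \<theta> \<beta> v \<omega> \<and>
     (\<forall>t\<in>{0..T}. (l\<^sub>x t, l\<^sub>y t, l\<^sub>\<theta> t, l\<^sub>\<beta> t) \<noteq> 0) \<and>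
     solves_ae T l\<^sub>x (\<lambda>t. 0) \<and>
     solves_ae T l\<^sub>y (\<lambda>t. 0) \<and>
     solves_ae T l\<^sub>\<theta> (\<lambda>t. v t * (l\<^sub>x t * sin (\<theta> t) - l\<^sub>y t * cos (\<theta> t))) \<and>
     solves_ae T l\<^sub>\<beta> (\<lambda>t. v t * l\<^sub>\<beta> t * cos (\<beta> t)) \<and>
     (\<forall>t\<in>{0..T}. \<forall>z\<in>control_set.
        hamiltonian (x t, y t, \<theta> t, \<beta> t) (l\<^sub>x t, l\<^sub>y t, l\<^sub>\<theta> t, l\<^sub>\<beta> t) z
        \<le> hamiltonian (x t, y t, \<theta> t, \<beta> t) (l\<^sub>x t, l\<^sub>y t, l\<^sub>\<theta> t, l\<^sub>\<beta> t) (v t, \<omega> t))"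

(* The integration constants of the adjoint equations,
     l_x = c1,  l_y = c2,  l_theta = c1 y - c2 x + c3,  l_beta = c4 exp (int_0^t v cos beta),
   read off at t = 0. For an extremal these identities then hold on all of [0, T] as a
   consequence of the adjoint equations; they are not assumed. *)
definition adjoint_constants ::
  "(real \<Rightarrow> real) \<Rightarrow> (real \<Rightarrow> real) \<Rightarrow>
   (real \<Rightarrow> real) \<Rightarrow> (real \<Rightarrow> real) \<Rightarrow> (real \<Rightarrow> real) \<Rightarrow> (real \<Rightarrow> real) \<Rightarrow>
   real \<Rightarrow> real \<Rightarrow> real \<Rightarrow> real \<Rightarrow> bool" where
  "adjoint_constants x y l\<^sub>x l\<^sub>y l\<^sub>\<theta> l\<^sub>\<beta> c1 c2 c3 c4 \<longleftrightarrow>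
     l\<^sub>x 0 = c1 \<and> l\<^sub>y 0 = c2 \<and> l\<^sub>\<theta> 0 = c1 * y 0 - c2 * x 0 + c3 \<and> l\<^sub>\<beta> 0 = c4"

definition phi_omega_singular_primitive ::
  "real \<Rightarrow> (real \<Rightarrow> config) \<Rightarrow> (real \<Rightarrow> costate) \<Rightarrow> real \<Rightarrow> real \<Rightarrow> bool" where
  "phi_omega_singular_primitive T q l t0 t1 \<longleftrightarrow>
     t0 < t1 \<and> {t0..t1} \<subseteq> {0..T} \<and>
     (\<forall>t\<in>{t0..t1}. phi_omega (q t) (l t) = 0) \<and>
     \<not> ((\<forall>t\<in>{t0..t1}. phi_v (q t) (l t) = 0) \<and> (\<forall>t\<in>{t0..t1}. phi_omega (q t) (l t) = 0))"

(* Insensitive to changing the control on a null set, which does not affect the trajectory. *)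
definition straight_segment ::
  "(real \<Rightarrow> real) \<Rightarrow> (real \<Rightarrow> real) \<Rightarrow> real \<Rightarrow> real \<Rightarrow> bool" where
  "straight_segment v \<omega> a b \<longleftrightarrow>
     a < b \<and> (\<exists>s\<in>{1, -1}. AE t\<in>{a..b} in lebesgue. v t = s \<and> \<omega> t = 0)"

(* "omega(t) = g(t) for all t in [a, b]". Where phi_omega = 0, neither the maximum condition
   nor the (almost everywhere) state equations constrain omega on a null set of times. So the
   identity is stated for almost every t and, moreover, at every single t at which the state
   equation theta' = omega holds; thus at all t in [a, b] if omega is chosen as theta' there. *)
definition steering_equals ::
  "(real \<Rightarrow> real) \<Rightarrow> (real \<Rightarrow> real) \<Rightarrow> real \<Rightarrow> real \<Rightarrow> (real \<Rightarrow> real) \<Rightarrow> bool" where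
  "steering_equals \<theta> \<omega> a b g \<longleftrightarrow>
     (AE t\<in>{a..b} in lebesgue. \<omega> t = g t) \<and>
     (\<forall>t\<in>{a..b}. (\<theta> has_real_derivative \<omega> t) (at t within {a..b}) \<longrightarrow> \<omega> t = g t)"

definition ell :: "real \<Rightarrow> real \<Rightarrow> real \<Rightarrow> (real \<times> real) set" where
  "ell c1 c2 c3 = {(X, Y). c1 * Y - c2 * X + c3 = 0}"

definition signed_dist :: "real \<Rightarrow> real \<Rightarrow> real \<Rightarrow> real \<times> real \<Rightarrow> real" where
  "signed_dist c1 c2 c3 = (\<lambda>(X, Y). (c1 * Y - c2 * X + c3) / norm (c1, c2))"

(* Oriented angle from (c1, c2) to (cos theta, sin theta); only its class modulo 2 * pi
   matters. Meaningful for (c1, c2) nonzero. *)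
definition line_angle :: "real \<Rightarrow> real \<Rightarrow> real \<Rightarrow> real" where
  "line_angle c1 c2 \<theta> = \<theta> - Arg (Complex c1 c2)"

definition angle_between :: "real \<Rightarrow> real \<Rightarrow> real \<Rightarrow> bool" where
  "angle_between a b \<phi> \<longleftrightarrow> (\<exists>\<psi>. [\<phi> = \<psi>] (rmod (2 * pi)) \<and> a \<le> \<psi> \<and> \<psi> \<le> b)"

end

theory Submission
  imports Defs
begin

text \<open>
  Put \<open>\<phi> = \<phi>\<^sub>v\<close> and \<open>\<psi> = c1 sin \<theta> - c2 cos \<theta> + \<lambda>\<^sub>\<beta> cos \<beta>\<close>. Almost everywhere
  \<open>\<phi>\<^sub>\<omega>' = v \<psi>\<close>, \<open>\<phi>' = -\<omega> \<psi>\<close> and \<open>\<psi>' = \<omega> \<phi> + v \<lambda>\<^sub>\<beta>\<close>. Along a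
  \<open>\<phi>\<^sub>\<omega>\<close>-singular primitive this makes \<open>\<phi>\<close> a nonzero constant, hence \<open>v = sgn \<phi>\<close>, \<open>\<psi> = 0\<close> and
  \<open>\<omega> \<phi> + v \<lambda>\<^sub>\<beta> = 0\<close>. At almost every time of a straight segment \<open>\<omega> = 0\<close>, so
  \<open>\<lambda>\<^sub>\<beta>\<close> vanishes there, and then everywhere, since it solves a linear homogeneous equation. Therefore
  the first alternative of the theorem always holds: \<open>c4 = 0\<close>, \<open>\<lambda>\<^sub>\<theta> = -\<lambda>\<^sub>\<beta> = 0\<close>
  on the primitive, which puts the robot on the line, \<open>\<omega> = 0\<close>, and \<open>\<psi> = 0\<close> says that the
  orientation is parallel to \<open>(c1, c2)\<close>.
\<close>

section \<open>Absolute continuity\<close>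

text \<open>The intervals of a tagged partial division do not overlap, so their total length is the
  measure of their union and is bounded by the measure of any enclosing set. In this form absolute
  continuity applies to the intervals caught in a small open neighbourhood of a null set.\<close>

lemma abs_continuous_on_small_variation:
  assumes "abs_continuous_on a b f" "\<epsilon> > 0"
  shows "\<exists>\<delta>>0. \<forall>p S. p tagged_partial_division_of {a..b} \<and> \<Union>(snd ` p) \<subseteq> S \<and> S \<in> lmeasurable \<and>
       measure lebesgue S < \<delta> \<longrightarrow> (\<Sum>(t, K)\<in>p. \<bar>f (Sup K) - f (Inf K)\<bar>) < \<epsilon>"
proof -
  obtain \<delta> where "\<delta> > 0" and \<delta>: "\<And>D. \<lbrakk>D division_of (\<Union>D); \<Union>D \<subseteq> {a..b}; (\<Sum>K\<in>D. Sup K - Inf K) < \<delta>\<rbrakk>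
      \<Longrightarrow> (\<Sum>K\<in>D. \<bar>f (Sup K) - f (Inf K)\<bar>) < \<epsilon>"
    using assms unfolding abs_continuous_on_def by meson
  show ?thesis
  proof (intro exI[of _ \<delta>] conjI allI impI \<open>\<delta> > 0\<close>; (elim conjE)?)
    fix p and S :: "real set"
    assume p: "p tagged_partial_division_of {a..b}" and S: "\<Union>(snd ` p) \<subseteq> S" "S \<in> lmeasurable"
      "measure lebesgue S < \<delta>"
    have div: "snd ` p division_of \<Union>(snd ` p)"
      by (rule partial_division_of_tagged_division[OF p])
    have sub: "\<Union>(snd ` p) \<subseteq> {a..b}"
      using tagged_partial_division_ofD(3)[OF p] by fastforce
    have *: "K \<in> snd ` p \<Longrightarrow> Sup K - Inf K = measure lebesgue K" for K
      using division_ofD(3,4)[OF div, of K] by auto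
    have "(\<Sum>K\<in>snd ` p. Sup K - Inf K) = measure lebesgue (\<Union>(snd ` p))"
      using content_division[OF div] * by simp
    also have "\<dots> \<le> measure lebesgue S"
      using lmeasurable_division[OF div] S by (intro measure_mono_fmeasurable) auto
    finally have "(\<Sum>K\<in>snd ` p. \<bar>f (Sup K) - f (Inf K)\<bar>) < \<epsilon>"
      using \<delta>[OF div sub] S by simp
    moreover have "(\<Sum>(t, K)\<in>p. \<bar>f (Sup K) - f (Inf K)\<bar>) = (\<Sum>K\<in>snd ` p. \<bar>f (Sup K) - f (Inf K)\<bar>)"
    proof -
      let ?d = "\<lambda>K. if K = {} then 0 else \<bar>f (Sup K) - f (Inf K)\<bar>"
      have "(\<Sum>(t, K)\<in>p. ?d K) = (\<Sum>K\<in>snd ` p. ?d K)"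
      proof (rule sum.over_tagged_division_lemma[OF tagged_partial_division_of_Union_self[OF p]])
        fix u w :: real assume "box u w = {}"
        then show "?d (cbox u w) = 0" by (cases "u = w") auto
      qed
      moreover have "(\<Sum>(t, K)\<in>p. ?d K) = (\<Sum>(t, K)\<in>p. \<bar>f (Sup K) - f (Inf K)\<bar>)"
        using tagged_partial_division_ofD(2)[OF p] by (intro sum.cong) fastforce+
      moreover have "(\<Sum>K\<in>snd ` p. ?d K) = (\<Sum>K\<in>snd ` p. \<bar>f (Sup K) - f (Inf K)\<bar>)"
        using division_ofD(3)[OF div] by (intro sum.cong) auto
      ultimately show ?thesis by simp
    qed
    ultimately show "(\<Sum>(t, K)\<in>p. \<bar>f (Sup K) - f (Inf K)\<bar>) < \<epsilon>" by simp
  qed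
qed

text \<open>The exceptional null set is enclosed in an open set of small measure; a tagged division that
  is fine for a gauge shrinking into this set at the exceptional points and adapted to the
  derivative elsewhere splits the increment \<open>f b - f a\<close> into a part controlled by absolute
  continuity and a part controlled by the sign of the derivative.\<close>
lemma abs_continuous_on_ae_nonneg_derivative_imp_le:
  fixes f :: "real \<Rightarrow> real"
  assumes ac: "abs_continuous_on a b f" and "a \<le> b"
    and ae: "AE t\<in>{a..b} in lebesgue. \<exists>D\<ge>0. (f has_real_derivative D) (at t within {a..b})"
  shows "f a \<le> f b"
proof (rule field_le_epsilon)
  fix e0 :: real assume "e0 > 0"
  \<comment> \<open>The increment loses at most \<open>e\<close> over the exceptional intervals and
    \<open>e * (b - a)\<close> over the others, which add up to \<open>e0\<close>.\<close>
  define e where "e = e0 / (1 + (b - a))"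
  have "e > 0"
    using \<open>e0 > 0\<close> \<open>a \<le> b\<close> by (auto simp: e_def)
  have "e * (1 + (b - a)) = e0"
    using \<open>a \<le> b\<close> by (simp add: e_def)
  then have e: "e + e * (b - a) = e0" by (simp add: distrib_left)
  obtain N where N: "N \<in> null_sets lebesgue" and deriv:
    "\<And>t. t \<in> {a..b} - N \<Longrightarrow> \<exists>D\<ge>0. (f has_real_derivative D) (at t within {a..b})"
    by (rule AE_E3[OF ae]) auto
  obtain \<delta> where "\<delta> > 0" and \<delta>:
    "\<And>p S. \<lbrakk>p tagged_partial_division_of {a..b}; \<Union>(snd ` p) \<subseteq> S; S \<in> lmeasurable;
       measure lebesgue S < \<delta>\<rbrakk> \<Longrightarrow> (\<Sum>(t, K)\<in>p. \<bar>f (Sup K) - f (Inf K)\<bar>) < e"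
    using abs_continuous_on_small_variation[OF ac \<open>e > 0\<close>] by blast
  obtain S where "open S" "N \<subseteq> S" and SN: "S - N \<in> lmeasurable" "emeasure lebesgue (S - N) < ennreal \<delta>"
    using sets_lebesgue_outer_open[OF _ \<open>\<delta> > 0\<close>, of N] N by auto
  \<comment> \<open>The outer approximation bounds only the measure of \<open>S - N\<close>; since
    \<open>N\<close> is null, the bound passes to \<open>S\<close>.\<close>
  have "emeasure lebesgue S = emeasure lebesgue (S - N)"
    using N \<open>open S\<close> by (intro emeasure_Diff_null_set[symmetric]) auto
  then have less: "emeasure lebesgue S < ennreal \<delta>"
    using SN by simp
  then have S: "S \<in> lmeasurable"
    using \<open>open S\<close> by (intro fmeasurableI) (auto intro: order.strict_trans)
  then have "measure lebesgue S < \<delta>"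
    using less by (simp add: emeasure_eq_measure2 ennreal_less_iff)
  \<comment> \<open>Off \<open>N\<close> the condition is a straddle estimate: the linear
    approximations at \<open>t\<close> to the left and to the right are combined, so it applies to
    an interval containing its tag anywhere.\<close>
  define good where "good t r \<longleftrightarrow> (t \<in> N \<longrightarrow> ball t r \<subseteq> S) \<and>
     (t \<in> {a..b} - N \<longrightarrow> (\<forall>u\<in>{a..b}\<inter>ball t r. \<forall>w\<in>{a..b}\<inter>ball t r. u \<le> t \<and> t \<le> w \<longrightarrow>
        f w - f u \<ge> - e * (w - u)))" for t r
  have "\<exists>r. r > 0 \<and> good t r" for t
  proof (cases "t \<in> {a..b} - N")
    case True
    then obtain D where "D \<ge> 0" "(f has_real_derivative D) (at t within {a..b})"
      using deriv by blast
    then obtain r where "r > 0" and r: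
      "\<And>y. y \<in> {a..b} \<Longrightarrow> \<bar>y - t\<bar> < r \<Longrightarrow> \<bar>f y - f t - D * (y - t)\<bar> \<le> e * \<bar>y - t\<bar>"
      using \<open>e > 0\<close> unfolding has_field_derivative_def has_derivative_within_alt real_norm_def
      by blast
    show ?thesis
      unfolding good_def
    proof (intro exI conjI impI ballI; (elim conjE)?)
      fix u w assume uw: "u \<in> {a..b} \<inter> ball t r" "w \<in> {a..b} \<inter> ball t r" "u \<le> t" "t \<le> w"
      have "D * (t - u) \<ge> 0" "D * (w - t) \<ge> 0"
        using uw \<open>D \<ge> 0\<close> by auto
      then show "f w - f u \<ge> - e * (w - u)"
        using r[of u] r[of w] uw by (auto simp: dist_real_def algebra_simps)
    qed (use True \<open>r > 0\<close> in auto)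
  next
    case False
    obtain r where "r > 0" "t \<in> N \<longrightarrow> ball t r \<subseteq> S"
      using \<open>open S\<close> \<open>N \<subseteq> S\<close> unfolding open_contains_ball by (metis subsetD zero_less_one)
    then show ?thesis using False unfolding good_def by blast
  qed
  then obtain r where r: "\<And>t. r t > 0 \<and> good t (r t)"
    by metis
  have rN: "ball t (r t) \<subseteq> S" if "t \<in> N" for t
    using r[of t] that unfolding good_def by blast
  have rD: "f w - f u \<ge> - e * (w - u)"
    if "t \<in> {a..b} - N" "u \<in> {a..b} \<inter> ball t (r t)" "w \<in> {a..b} \<inter> ball t (r t)" "u \<le> t" "t \<le> w" for t u w
    using r[of t] that unfolding good_def by blast
  obtain p where p: "p tagged_division_of {a..b}" and fine: "(\<lambda>t. ball t (r t)) fine p"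
    using fine_division_exists_real[OF gauge_ball_dependent, of r] r by blast
  have K: "t \<in> K \<and> K \<subseteq> {a..b} \<and> K \<subseteq> ball t (r t) \<and> Inf K \<in> K \<and> Sup K \<in> K \<and> Inf K \<le> t \<and> t \<le> Sup K"
    if "(t, K) \<in> p" for t K
    using tagged_division_ofD(2-4)[OF p that] fineD[OF fine that] by auto
  define q where "q = {z \<in> p. fst z \<in> N}"
  have "q \<subseteq> p" by (auto simp: q_def)
  have fin: "finite p" using p by blast
  have "(\<Sum>(t, K)\<in>q. \<bar>f (Sup K) - f (Inf K)\<bar>) < e"
  proof (rule \<delta>[of q S])
    show "q tagged_partial_division_of {a..b}"
      using p \<open>q \<subseteq> p\<close> unfolding tagged_division_of_def
      by (blast intro: tagged_partial_division_subset)
    show "\<Union>(snd ` q) \<subseteq> S"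
    proof
      fix s assume "s \<in> \<Union>(snd ` q)"
      then obtain t K where "(t, K) \<in> p" "t \<in> N" "s \<in> K" by (auto simp: q_def)
      then show "s \<in> S" using K[of t K] rN[of t] by blast
    qed
  qed fact+
  moreover have "(\<Sum>(t, K)\<in>q. f (Sup K) - f (Inf K)) \<ge> (\<Sum>(t, K)\<in>q. - \<bar>f (Sup K) - f (Inf K)\<bar>)"
    by (intro sum_mono) auto
  ultimately have 1: "(\<Sum>(t, K)\<in>q. f (Sup K) - f (Inf K)) \<ge> - e"
    by (simp add: sum_negf case_prod_unfold)
  have "(\<Sum>(t, K)\<in>p - q. - e * (Sup K - Inf K)) \<le> (\<Sum>(t, K)\<in>p - q. f (Sup K) - f (Inf K))"
  proof (intro sum_mono, clarify)
    fix t K assume tK: "(t, K) \<in> p" "(t, K) \<notin> q"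
    show "- e * (Sup K - Inf K) \<le> f (Sup K) - f (Inf K)"
    proof (rule rD[of t])
      show "t \<in> {a..b} - N" using K[OF tK(1)] tK by (auto simp: q_def)
    qed (use K[OF tK(1)] in blast)+
  qed
  \<comment> \<open>The omitted terms are nonpositive, so the lower bound may be summed over all of
    \<open>p\<close>, where the lengths telescope to \<open>b - a\<close>.\<close>
  moreover have "(\<Sum>(t, K)\<in>p. - e * (Sup K - Inf K)) \<le> (\<Sum>(t, K)\<in>p - q. - e * (Sup K - Inf K))"
  proof -
    have "(\<Sum>(t, K)\<in>p - q. e * (Sup K - Inf K)) \<le> (\<Sum>(t, K)\<in>p. e * (Sup K - Inf K))"
    proof (rule sum_mono2[OF fin])
      fix z assume "z \<in> p - (p - q)"
      then have "Inf (snd z) \<le> Sup (snd z)" using K[of "fst z" "snd z"] by auto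
      then show "0 \<le> (case z of (t, K) \<Rightarrow> e * (Sup K - Inf K))"
        using \<open>e > 0\<close> by (simp add: case_prod_unfold)
    qed auto
    then show ?thesis by (simp add: sum_negf case_prod_unfold)
  qed
  moreover have "(\<Sum>(t, K)\<in>p. - e * (Sup K - Inf K)) = - e * (b - a)"
    using additive_tagged_division_1[OF \<open>a \<le> b\<close> p, of "\<lambda>x. x"]
    by (simp add: case_prod_unfold sum_distrib_left[symmetric] sum_negf)
  ultimately have 2: "(\<Sum>(t, K)\<in>p - q. f (Sup K) - f (Inf K)) \<ge> - e * (b - a)" by simp
  have "f b - f a = (\<Sum>(t, K)\<in>p. f (Sup K) - f (Inf K))"
    using additive_tagged_division_1[OF \<open>a \<le> b\<close> p, of f] by simp
  also have "\<dots> = (\<Sum>(t, K)\<in>p - q. f (Sup K) - f (Inf K)) + (\<Sum>(t, K)\<in>q. f (Sup K) - f (Inf K))"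
    by (rule sum.subset_diff[OF \<open>q \<subseteq> p\<close> fin])
  finally show "f a \<le> f b + e0" using 1 2 e by simp
qed

section \<open>Restriction, continuity and algebra of absolutely continuous functions\<close>

lemma abs_continuous_on_subinterval:
  assumes "abs_continuous_on a b f" "{c..d} \<subseteq> {a..b}"
  shows "abs_continuous_on c d f"
  using assms unfolding abs_continuous_on_def by (meson order_trans)

lemma abs_continuous_on_imp_continuous_on:
  assumes ac: "abs_continuous_on a b f"
  shows "continuous_on {a..b} f"
  unfolding continuous_on_iff
proof (intro ballI allI impI)
  fix t \<epsilon> :: real assume t: "t \<in> {a..b}" and "\<epsilon> > 0"
  obtain \<delta> where "\<delta> > 0" and \<delta>: "\<And>D. \<lbrakk>D division_of (\<Union>D); \<Union>D \<subseteq> {a..b}; (\<Sum>K\<in>D. Sup K - Inf K) < \<delta>\<rbrakk>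
      \<Longrightarrow> (\<Sum>K\<in>D. \<bar>f (Sup K) - f (Inf K)\<bar>) < \<epsilon>"
    using ac \<open>\<epsilon> > 0\<close> unfolding abs_continuous_on_def by meson
  have *: "\<bar>f w - f u\<bar> < \<epsilon>" if "u \<in> {a..b}" "w \<in> {a..b}" "u \<le> w" "w - u < \<delta>" for u w
    using \<delta>[of "{{u..w}}"] division_of_self[of u w] that by auto
  have "dist (f s) (f t) < \<epsilon>" if "s \<in> {a..b}" "dist s t < \<delta>" for s
    using *[of s t] *[of t s] that t by (cases "s \<le> t") (auto simp: dist_real_def)
  then show "\<exists>\<delta>>0. \<forall>s\<in>{a..b}. dist s t < \<delta> \<longrightarrow> dist (f s) (f t) < \<epsilon>"
    using \<open>\<delta> > 0\<close> by blast
qed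

lemma abs_continuous_on_bounded:
  assumes "abs_continuous_on a b f"
  obtains M where "M \<ge> 0" "\<And>t. t \<in> {a..b} \<Longrightarrow> \<bar>f t\<bar> \<le> M"
proof -
  have "bounded (f ` {a..b})"
    using compact_continuous_image[OF abs_continuous_on_imp_continuous_on[OF assms]] compact_imp_bounded
    by blast
  then obtain M where "\<forall>t\<in>{a..b}. \<bar>f t\<bar> \<le> M" by (auto simp: bounded_iff)
  then show thesis using that[of "max 0 M"] by force
qed

text \<open>A comparison principle from which sums, products, Lipschitz compositions and the
  exponential all follow by estimating a single increment.\<close>

lemma abs_continuous_on_dominated:
  assumes f: "abs_continuous_on a b f" and g: "abs_continuous_on a b g" and "C \<ge> 0"
    and h: "\<And>u w. \<lbrakk>u \<in> {a..b}; w \<in> {a..b}\<rbrakk> \<Longrightarrow> \<bar>h w - h u\<bar> \<le> C * (\<bar>f w - f u\<bar> + \<bar>g w - g u\<bar>)"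
  shows "abs_continuous_on a b h"
  unfolding abs_continuous_on_def
proof (intro allI impI)
  fix \<epsilon> :: real assume "\<epsilon> > 0"
  \<comment> \<open>Using \<open>C + 1\<close> instead of \<open>C\<close> avoids division by zero
    and makes \<open>C * (e + e) < \<epsilon>\<close> strict.\<close>
  define e where "e = \<epsilon> / (2 * (C + 1))"
  have "e > 0"
    using \<open>\<epsilon> > 0\<close> \<open>C \<ge> 0\<close> by (simp add: e_def)
  have "2 * (C + 1) * e = \<epsilon>"
    using \<open>C \<ge> 0\<close> by (simp add: e_def)
  then have e: "C * (e + e) < \<epsilon>"
    using \<open>e > 0\<close> by (simp add: algebra_simps)
  obtain \<delta>1 where "\<delta>1 > 0" and \<delta>1: "\<And>D. \<lbrakk>D division_of (\<Union>D); \<Union>D \<subseteq> {a..b}; (\<Sum>K\<in>D. Sup K - Inf K) < \<delta>1\<rbrakk>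
      \<Longrightarrow> (\<Sum>K\<in>D. \<bar>f (Sup K) - f (Inf K)\<bar>) < e"
    using f \<open>e > 0\<close> unfolding abs_continuous_on_def by meson
  obtain \<delta>2 where "\<delta>2 > 0" and \<delta>2: "\<And>D. \<lbrakk>D division_of (\<Union>D); \<Union>D \<subseteq> {a..b}; (\<Sum>K\<in>D. Sup K - Inf K) < \<delta>2\<rbrakk>
      \<Longrightarrow> (\<Sum>K\<in>D. \<bar>g (Sup K) - g (Inf K)\<bar>) < e"
    using g \<open>e > 0\<close> unfolding abs_continuous_on_def by meson
  show "\<exists>\<delta>>0. \<forall>D. D division_of (\<Union>D) \<and> \<Union>D \<subseteq> {a..b} \<and> (\<Sum>K\<in>D. Sup K - Inf K) < \<delta>
        \<longrightarrow> (\<Sum>K\<in>D. \<bar>h (Sup K) - h (Inf K)\<bar>) < \<epsilon>"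
  proof (intro exI[of _ "min \<delta>1 \<delta>2"] conjI allI impI; (elim conjE)?)
    fix D assume D: "D division_of (\<Union>D)" "\<Union>D \<subseteq> {a..b}" "(\<Sum>K\<in>D. Sup K - Inf K) < min \<delta>1 \<delta>2"
    have K: "Inf K \<in> {a..b} \<and> Sup K \<in> {a..b}" if K: "K \<in> D" for K
    proof -
      obtain u w where "K = cbox u w" using division_ofD(4)[OF D(1) K] by blast
      then have "Inf K \<in> K" "Sup K \<in> K" using division_ofD(3)[OF D(1) K] by auto
      then show ?thesis using K D(2) by blast
    qed
    have "(\<Sum>K\<in>D. \<bar>h (Sup K) - h (Inf K)\<bar>)
        \<le> (\<Sum>K\<in>D. C * (\<bar>f (Sup K) - f (Inf K)\<bar> + \<bar>g (Sup K) - g (Inf K)\<bar>))"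
      using K by (intro sum_mono h) auto
    also have "\<dots> = C * ((\<Sum>K\<in>D. \<bar>f (Sup K) - f (Inf K)\<bar>) + (\<Sum>K\<in>D. \<bar>g (Sup K) - g (Inf K)\<bar>))"
      by (simp only: sum_distrib_left[symmetric] sum.distrib)
    also have "\<dots> \<le> C * (e + e)"
      using \<delta>1[OF D(1,2)] \<delta>2[OF D(1,2)] D(3) \<open>C \<ge> 0\<close> by (intro mult_left_mono) auto
    finally show "(\<Sum>K\<in>D. \<bar>h (Sup K) - h (Inf K)\<bar>) < \<epsilon>" using e by linarith
  qed (use \<open>\<delta>1 > 0\<close> \<open>\<delta>2 > 0\<close> in auto)
qed

lemma abs_continuous_on_const: "abs_continuous_on a b (\<lambda>t. c)"
  unfolding abs_continuous_on_def by (auto intro!: exI[of _ 1])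

lemma abs_continuous_on_add:
  assumes "abs_continuous_on a b f" "abs_continuous_on a b g"
  shows "abs_continuous_on a b (\<lambda>t. f t + g t)"
  by (rule abs_continuous_on_dominated[OF assms, of 1]) auto

lemma abs_continuous_on_mult:
  assumes f: "abs_continuous_on a b f" and g: "abs_continuous_on a b g"
  shows "abs_continuous_on a b (\<lambda>t. f t * g t)"
proof -
  obtain M where M: "M \<ge> 0" "\<And>t. t \<in> {a..b} \<Longrightarrow> \<bar>f t\<bar> \<le> M"
    using abs_continuous_on_bounded[OF f] by metis
  obtain N where N: "N \<ge> 0" "\<And>t. t \<in> {a..b} \<Longrightarrow> \<bar>g t\<bar> \<le> N"
    using abs_continuous_on_bounded[OF g] by metis
  show ?thesis
  proof (rule abs_continuous_on_dominated[OF f g, of "M + N"])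
    fix u w assume uw: "u \<in> {a..b}" "w \<in> {a..b}"
    have "f w * g w - f u * g u = (f w - f u) * g w + f u * (g w - g u)"
      by (simp add: algebra_simps)
    then have "\<bar>f w * g w - f u * g u\<bar> \<le> \<bar>f w - f u\<bar> * \<bar>g w\<bar> + \<bar>f u\<bar> * \<bar>g w - g u\<bar>"
      by (metis abs_mult abs_triangle_ineq)
    also have "\<dots> \<le> \<bar>f w - f u\<bar> * (M + N) + (M + N) * \<bar>g w - g u\<bar>"
      using M(1) M(2)[OF uw(1)] N(1) N(2)[OF uw(2)] by (intro add_mono mult_mono) auto
    finally show "\<bar>f w * g w - f u * g u\<bar> \<le> (M + N) * (\<bar>f w - f u\<bar> + \<bar>g w - g u\<bar>)"
      by (simp add: algebra_simps)
  qed (use M N in auto)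
qed

lemma abs_continuous_on_compose_lipschitz:
  assumes f: "abs_continuous_on a b f" and F: "1-lipschitz_on UNIV F"
  shows "abs_continuous_on a b (\<lambda>t. F (f t))"
proof (rule abs_continuous_on_dominated[OF f f, of 1])
  show "\<bar>F (f w) - F (f u)\<bar> \<le> 1 * (\<bar>f w - f u\<bar> + \<bar>f w - f u\<bar>)" for u w
    using lipschitz_onD[OF F, of "f w" "f u"] abs_ge_zero[of "f w - f u"]
    unfolding dist_real_def by (simp del: abs_ge_zero)
qed simp

text \<open>The exponential is Lipschitz on a bounded interval by the mean value bound. It serves as
  the integrating factor in \<open>ac_primitive_linear_ode_zero\<close>.\<close>

lemma abs_continuous_on_exp: "abs_continuous_on a b (\<lambda>t. exp (k * t))"
proof (rule abs_continuous_on_dominated)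
  show "abs_continuous_on a b (\<lambda>t. t)"
    unfolding abs_continuous_on_def
  proof (intro allI impI)
    fix \<epsilon> :: real assume "\<epsilon> > 0"
    have "(\<Sum>K\<in>D. \<bar>Sup K - Inf K\<bar>) = (\<Sum>K\<in>D. Sup K - Inf K)"
      if D: "D division_of (\<Union>D)" for D :: "real set set"
    proof (rule sum.cong[OF refl])
      fix K assume "K \<in> D"
      then show "\<bar>Sup K - Inf K\<bar> = Sup K - Inf K"
        using division_ofD(3,4)[OF D, of K] by auto
    qed
    then show "\<exists>\<delta>>0. \<forall>D. D division_of (\<Union>D) \<and> \<Union>D \<subseteq> {a..b} \<and> (\<Sum>K\<in>D. Sup K - Inf K) < \<delta>
        \<longrightarrow> (\<Sum>K\<in>D. \<bar>Sup K - Inf K\<bar>) < \<epsilon>"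
      using \<open>\<epsilon> > 0\<close> by (intro exI[of _ \<epsilon>]) auto
  qed
  then show "abs_continuous_on a b (\<lambda>t. t)" .
  let ?C = "\<bar>k\<bar> * exp (\<bar>k\<bar> * (\<bar>a\<bar> + \<bar>b\<bar>))"
  show "0 \<le> ?C" by simp
  fix u w assume uw: "u \<in> {a..b}" "w \<in> {a..b}"
  have "norm (exp (k * w) - exp (k * u)) \<le> ?C * norm (w - u)"
  proof (rule field_differentiable_bound[where f' = "\<lambda>t. k * exp (k * t)"])
    fix z assume z: "z \<in> {a..b}"
    show "((\<lambda>t. exp (k * t)) has_real_derivative k * exp (k * z)) (at z within {a..b})"
      by (auto intro!: derivative_eq_intros)
    have "k * z \<le> \<bar>k\<bar> * \<bar>z\<bar>" by (metis abs_ge_self abs_mult)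
    also have "\<dots> \<le> \<bar>k\<bar> * (\<bar>a\<bar> + \<bar>b\<bar>)" using z by (intro mult_left_mono) auto
    finally show "norm (k * exp (k * z)) \<le> ?C" by (simp add: abs_mult mult_left_mono)
  qed (use uw in auto)
  also have "\<dots> \<le> ?C * (\<bar>w - u\<bar> + \<bar>w - u\<bar>)"
    unfolding real_norm_def by (intro mult_left_mono) auto
  finally show "\<bar>exp (k * w) - exp (k * u)\<bar> \<le> ?C * (\<bar>w - u\<bar> + \<bar>w - u\<bar>)" by simp
qed

section \<open>Absolutely continuous primitives\<close>

text \<open>\<open>solves_ae\<close> is tied to intervals starting at 0; a free left end allows
  restriction to the singular primitive.\<close>

definition ac_primitive :: "real \<Rightarrow> real \<Rightarrow> (real \<Rightarrow> real) \<Rightarrow> (real \<Rightarrow> real) \<Rightarrow> bool" where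
  "ac_primitive a b f g \<longleftrightarrow> abs_continuous_on a b f \<and>
     (AE t\<in>{a..b} in lebesgue. (f has_real_derivative g t) (at t within {a..b}))"

lemma solves_ae_iff_ac_primitive: "solves_ae T f g \<longleftrightarrow> ac_primitive 0 T f g"
  by (simp add: solves_ae_def ac_primitive_def)

lemma ac_primitive_subinterval:
  assumes "ac_primitive a b f g" "{c..d} \<subseteq> {a..b}"
  shows "ac_primitive c d f g"
proof -
  have "AE t\<in>{c..d} in lebesgue. (f has_real_derivative g t) (at t within {c..d})"
  proof -
    have "AE t\<in>{a..b} in lebesgue. (f has_real_derivative g t) (at t within {a..b})"
      using assms(1) by (simp add: ac_primitive_def)
    then show ?thesis
      by eventually_elim (use assms(2) has_field_derivative_subset in blast)
  qed
  then show ?thesis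
    using assms abs_continuous_on_subinterval unfolding ac_primitive_def by blast
qed

lemma ac_primitive_cong_AE:
  assumes "ac_primitive a b f g" "AE t\<in>{a..b} in lebesgue. g t = h t"
  shows "ac_primitive a b f h"
proof -
  have "AE t\<in>{a..b} in lebesgue. (f has_real_derivative g t) (at t within {a..b})"
    using assms(1) unfolding ac_primitive_def by blast
  with assms(2) have "AE t\<in>{a..b} in lebesgue. (f has_real_derivative h t) (at t within {a..b})"
    by eventually_elim auto
  then show ?thesis using assms(1) unfolding ac_primitive_def by blast
qed

lemma ac_primitive_const: "ac_primitive a b (\<lambda>t. c) (\<lambda>t. 0)"
  by (auto simp: ac_primitive_def abs_continuous_on_const)

lemma ac_primitive_exp: "ac_primitive a b (\<lambda>t. exp (k * t)) (\<lambda>t. k * exp (k * t))"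
  unfolding ac_primitive_def
  by (auto intro!: abs_continuous_on_exp AE_I2 derivative_eq_intros)

lemma ac_primitive_add:
  assumes "ac_primitive a b f f'" "ac_primitive a b g g'"
  shows "ac_primitive a b (\<lambda>t. f t + g t) (\<lambda>t. f' t + g' t)"
proof -
  have "AE t\<in>{a..b} in lebesgue. (f has_real_derivative f' t) (at t within {a..b})"
    "AE t\<in>{a..b} in lebesgue. (g has_real_derivative g' t) (at t within {a..b})"
    using assms unfolding ac_primitive_def by blast+
  then have "AE t\<in>{a..b} in lebesgue.
      ((\<lambda>t. f t + g t) has_real_derivative f' t + g' t) (at t within {a..b})"
    by eventually_elim (auto intro: DERIV_add)
  then show ?thesis
    using assms abs_continuous_on_add unfolding ac_primitive_def by blast
qed

lemma ac_primitive_mult: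
  assumes "ac_primitive a b f f'" "ac_primitive a b g g'"
  shows "ac_primitive a b (\<lambda>t. f t * g t) (\<lambda>t. f' t * g t + f t * g' t)"
proof -
  have "AE t\<in>{a..b} in lebesgue. (f has_real_derivative f' t) (at t within {a..b})"
    "AE t\<in>{a..b} in lebesgue. (g has_real_derivative g' t) (at t within {a..b})"
    using assms unfolding ac_primitive_def by blast+
  then have "AE t\<in>{a..b} in lebesgue.
      ((\<lambda>t. f t * g t) has_real_derivative f' t * g t + f t * g' t) (at t within {a..b})"
    by eventually_elim (auto intro!: derivative_eq_intros)
  then show ?thesis
    using assms abs_continuous_on_mult unfolding ac_primitive_def by blast
qed

lemma ac_primitive_compose_lipschitz:
  assumes f: "ac_primitive a b f f'" and "1-lipschitz_on UNIV F"
    and F': "\<And>z. (F has_real_derivative F' z) (at z)"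
  shows "ac_primitive a b (\<lambda>t. F (f t)) (\<lambda>t. F' (f t) * f' t)"
proof -
  have "AE t\<in>{a..b} in lebesgue. (f has_real_derivative f' t) (at t within {a..b})"
    using f unfolding ac_primitive_def by blast
  then have "AE t\<in>{a..b} in lebesgue.
      ((\<lambda>t. F (f t)) has_real_derivative F' (f t) * f' t) (at t within {a..b})"
    by eventually_elim (auto intro: DERIV_chain2[OF F'])
  then show ?thesis
    using assms abs_continuous_on_compose_lipschitz unfolding ac_primitive_def by blast
qed

lemma lipschitz_on_UNIV_real_deriv:
  fixes F :: "real \<Rightarrow> real"
  assumes "\<And>z. (F has_real_derivative F' z) (at z)" "\<And>z. \<bar>F' z\<bar> \<le> 1"
  shows "1-lipschitz_on UNIV F"
  using field_differentiable_bound[of UNIV F F' 1] assms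
  by (intro lipschitz_onI) (auto simp: dist_norm)

lemma ac_primitive_sin:
  assumes "ac_primitive a b f f'"
  shows "ac_primitive a b (\<lambda>t. sin (f t)) (\<lambda>t. cos (f t) * f' t)"
  using DERIV_sin by (intro ac_primitive_compose_lipschitz[OF assms] lipschitz_on_UNIV_real_deriv[of _ cos]) auto

lemma ac_primitive_cos:
  assumes "ac_primitive a b f f'"
  shows "ac_primitive a b (\<lambda>t. cos (f t)) (\<lambda>t. - sin (f t) * f' t)"
  using DERIV_cos
  by (intro ac_primitive_compose_lipschitz[OF assms, where F' = "\<lambda>z. - sin z"]
      lipschitz_on_UNIV_real_deriv[of _ "\<lambda>z. - sin z"]) auto

section \<open>Monotonicity and uniqueness from a derivative known almost everywhere\<close>

lemma ac_primitive_nonneg_imp_le: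
  assumes "ac_primitive a b f g" "AE t\<in>{a..b} in lebesgue. g t \<ge> 0"
    and "a \<le> s" "s \<le> t" "t \<le> b"
  shows "f s \<le> f t"
proof (rule abs_continuous_on_ae_nonneg_derivative_imp_le[where a = s and b = t and f = f])
  have *: "ac_primitive s t f g"
    using assms by (intro ac_primitive_subinterval[OF assms(1)]) auto
  then show "abs_continuous_on s t f" by (simp add: ac_primitive_def)
  have "AE x\<in>{s..t} in lebesgue. (f has_real_derivative g x) (at x within {s..t})"
    using * by (simp add: ac_primitive_def)
  with assms(2) show "AE x\<in>{s..t} in lebesgue. \<exists>D\<ge>0. (f has_real_derivative D) (at x within {s..t})"
    by eventually_elim (use assms(3-5) in auto)
qed fact

lemma ac_primitive_nonpos_imp_ge:
  assumes "ac_primitive a b f g" "AE t\<in>{a..b} in lebesgue. g t \<le> 0"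
    and "a \<le> s" "s \<le> t" "t \<le> b"
  shows "f s \<ge> f t"
proof -
  have "ac_primitive a b (\<lambda>t. - 1 * f t) (\<lambda>t. 0 * f t + - 1 * g t)"
    by (intro ac_primitive_mult ac_primitive_const assms(1))
  from ac_primitive_nonneg_imp_le[OF this _ assms(3-5)] show ?thesis
    using assms(2) by simp
qed

lemma ac_primitive_zero_imp_const:
  assumes f: "ac_primitive a b f g" and "AE t\<in>{a..b} in lebesgue. g t = 0"
    and "s \<in> {a..b}" "t \<in> {a..b}"
  shows "f s = f t"
proof -
  have *: "ac_primitive a b f (\<lambda>t. 0)" by (rule ac_primitive_cong_AE[OF assms(1,2)])
  have "f s = f t" if "a \<le> s" "s \<le> t" "t \<le> b" for s t
    using ac_primitive_nonneg_imp_le[OF *] ac_primitive_nonpos_imp_ge[OF *] that by force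
  then show ?thesis using assms(3,4) by (metis atLeastAtMost_iff linear)
qed

lemma has_real_derivative_within_interval_unique:
  assumes "a < b" "t \<in> {a..b}" "(f has_real_derivative D) (at t within {a..b})"
    "(f has_real_derivative E) (at t within {a..b})"
  shows "D = E"
  using vector_derivative_unique_within_closed_interval[of a b t f D E] assms
  by (simp add: has_real_derivative_iff_has_vector_derivative)

text \<open>Derivatives within a nondegenerate interval are unique, also at its ends. This turns an
  identity valid along the whole primitive into a relation for the controls.\<close>

lemma ac_primitive_of_const:
  assumes "ac_primitive a b f g" "a < b" and const: "\<And>t. t \<in> {a..b} \<Longrightarrow> f t = c"
  shows "AE t\<in>{a..b} in lebesgue. g t = 0"
proof -
  have "AE t\<in>{a..b} in lebesgue. (f has_real_derivative g t) (at t within {a..b})"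
    using assms(1) unfolding ac_primitive_def by blast
  then show ?thesis
  proof eventually_elim
    case (elim t)
    show ?case
    proof
      assume t: "t \<in> {a..b}"
      have "((\<lambda>t. c) has_real_derivative 0) (at t within {a..b})" by simp
      then have "(f has_real_derivative 0) (at t within {a..b})"
        by (rule has_field_derivative_transform_within[OF _ zero_less_one t]) (use const in auto)
      then show "g t = 0"
        using has_real_derivative_within_interval_unique[OF \<open>a < b\<close> t] elim t by blast
    qed
  qed
qed

text \<open>A Gronwall argument: since the coefficient is bounded by 1,
  \<open>(f t)\<^sup>2 * exp (- 2 * t)\<close> is nonincreasing and
  \<open>(f t)\<^sup>2 * exp (2 * t)\<close> is nondecreasing. The first carries the zero forwards
  in time, the second backwards.\<close>

lemma ac_primitive_linear_ode_zero:
  assumes f: "ac_primitive a b f (\<lambda>t. c t * f t)"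
    and c: "\<And>t. t \<in> {a..b} \<Longrightarrow> \<bar>c t\<bar> \<le> 1"
    and s: "s \<in> {a..b}" "f s = 0" and t: "t \<in> {a..b}"
  shows "f t = 0"
proof -
  let ?F = "\<lambda>k t. f t * f t * exp (k * t)"
  let ?F' = "\<lambda>k t. (c t * f t * f t + f t * (c t * f t)) * exp (k * t) + f t * f t * (k * exp (k * t))"
  have F: "ac_primitive a b (?F k) (?F' k)" for k
    by (intro ac_primitive_mult f ac_primitive_exp)
  have F': "?F' k t = (2 * c t + k) * ((f t)\<^sup>2 * exp (k * t))" for k t
    by (simp add: algebra_simps power2_eq_square)
  show ?thesis
  proof (cases "s \<le> t")
    case True
    have "2 * c t + - 2 \<le> 0" if "t \<in> {a..b}" for t using c[OF that] by linarith
    then have "AE t\<in>{a..b} in lebesgue. ?F' (- 2) t \<le> 0"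
      unfolding F' by (intro AE_I2 impI mult_nonpos_nonneg[OF _ mult_nonneg_nonneg]) auto
    from ac_primitive_nonpos_imp_ge[OF F this, of s t] True s t
    show ?thesis by (auto simp: mult_le_0_iff)
  next
    case False
    have "2 * c t + 2 \<ge> 0" if "t \<in> {a..b}" for t using c[OF that] by linarith
    then have "AE t\<in>{a..b} in lebesgue. ?F' 2 t \<ge> 0"
      unfolding F' by (intro AE_I2 impI mult_nonneg_nonneg[OF _ mult_nonneg_nonneg]) auto
    from ac_primitive_nonneg_imp_le[OF F this, of t s] False s t
    show ?thesis by (auto simp: mult_le_0_iff)
  qed
qed

lemma AE_interval_imp_ex:
  fixes a b :: real
  assumes "AE t\<in>{a..b} in lebesgue. P t" "a < b"
  shows "\<exists>t\<in>{a..b}. P t"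
proof (rule ccontr)
  assume "\<not> ?thesis"
  with assms(1) have "AE t in lebesgue. t \<notin> {a..b}"
    by (auto elim!: AE_mp)
  then have "{a..b} \<in> null_sets lebesgue"
    by (subst AE_iff_null_sets) auto
  then show False
    using \<open>a < b\<close> by (auto simp: null_sets_def)
qed

section \<open>Singular arcs\<close>

text \<open>Testing the maximum against the control that keeps \<open>\<omega>\<close> and replaces
  \<open>v\<close> by \<open>sgn (phi_v q l)\<close> cancels the steering term. Together with the
  bound on \<open>v\<close> the resulting inequality leaves one value.\<close>

lemma maximum_condition_v:
  assumes "\<And>z. z \<in> control_set \<Longrightarrow> hamiltonian q l z \<le> hamiltonian q l (v, \<omega>)"
    and "(v, \<omega>) \<in> control_set" and "phi_v q l \<noteq> 0"
  shows "v = sgn (phi_v q l)"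
proof -
  obtain x y \<theta> \<beta> where q: "q = (x, y, \<theta>, \<beta>)" by (cases q)
  obtain a b c d where l: "l = (a, b, c, d)" by (cases l)
  have "(sgn (phi_v q l), \<omega>) \<in> control_set"
    using assms(2) by (auto simp: control_set_def sgn_if)
  from assms(1)[OF this] have *: "sgn (phi_v q l) * phi_v q l \<le> v * phi_v q l"
    by (simp add: q l)
  have v: "- 1 \<le> v" "v \<le> 1" using assms(2) by (auto simp: control_set_def)
  show ?thesis
  proof (cases "phi_v q l > 0")
    case True
    with * have "1 \<le> v" by simp
    then show ?thesis using v True by simp
  next
    case False
    then have neg: "phi_v q l < 0" using assms(3) by simp
    with * have "- 1 * phi_v q l \<le> v * phi_v q l" by simp
    then have "v \<le> - 1" using neg by (simp only: mult_le_cancel_right)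
    then show ?thesis using v neg by simp
  qed
qed

text \<open>The straight segment is kept out of the assumptions: the switching relations hold on
  every singular primitive, and the segment enters only through
  \<open>l\<beta>_zero_of_straight_segment\<close>.\<close>

locale singular_primitive =
  fixes T t0 t1 c1 c2 c3 c4 :: real
    and x y \<theta> \<beta> v \<omega> lx ly l\<theta> l\<beta> :: "real \<Rightarrow> real"
  assumes extremal: "extremal T x y \<theta> \<beta> v \<omega> lx ly l\<theta> l\<beta>"
    and constants: "adjoint_constants x y lx ly l\<theta> l\<beta> c1 c2 c3 c4"
    and singular: "phi_omega_singular_primitive T (\<lambda>t. (x t, y t, \<theta> t, \<beta> t))
           (\<lambda>t. (lx t, ly t, l\<theta> t, l\<beta> t)) t0 t1"
begin

lemma times: "t0 < t1" "{t0..t1} \<subseteq> {0..T}" "0 \<in> {0..T}"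
proof -
  show "t0 < t1" and sub: "{t0..t1} \<subseteq> {0..T}"
    using singular by (auto simp: phi_omega_singular_primitive_def)
  from \<open>t0 < t1\<close> have "t0 \<in> {t0..t1}" by simp
  with sub show "0 \<in> {0..T}" by fastforce
qed

lemma controls: "t \<in> {0..T} \<Longrightarrow> (v t, \<omega> t) \<in> control_set"
  using extremal by (simp add: extremal_def trajectory_def)

lemma v_bound: "t \<in> {0..T} \<Longrightarrow> \<bar>v t\<bar> \<le> 1"
  using controls[of t] by (auto simp: control_set_def)

lemma ac:
  "ac_primitive 0 T x (\<lambda>t. v t * cos (\<theta> t))"
  "ac_primitive 0 T y (\<lambda>t. v t * sin (\<theta> t))"
  "ac_primitive 0 T \<theta> \<omega>"
  "ac_primitive 0 T \<beta> (\<lambda>t. - v t * sin (\<beta> t) + \<omega> t)"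
  "ac_primitive 0 T lx (\<lambda>t. 0)"
  "ac_primitive 0 T ly (\<lambda>t. 0)"
  "ac_primitive 0 T l\<theta> (\<lambda>t. v t * (lx t * sin (\<theta> t) - ly t * cos (\<theta> t)))"
  "ac_primitive 0 T l\<beta> (\<lambda>t. v t * l\<beta> t * cos (\<beta> t))"
  using extremal unfolding extremal_def trajectory_def solves_ae_iff_ac_primitive by blast+

lemma lx_eq: "t \<in> {0..T} \<Longrightarrow> lx t = c1" and ly_eq: "t \<in> {0..T} \<Longrightarrow> ly t = c2"
  using ac_primitive_zero_imp_const[OF ac(5) _ times(3)] ac_primitive_zero_imp_const[OF ac(6) _ times(3)]
    constants by (auto simp: adjoint_constants_def)

text \<open>By the state equations for \<open>x\<close> and \<open>y\<close>, the difference of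
  \<open>l\<theta>\<close> and \<open>c1 * y - c2 * x\<close> has derivative zero almost everywhere;
  its value at time 0 is \<open>c3\<close>.\<close>

lemma l\<theta>_eq:
  assumes "t \<in> {0..T}"
  shows "l\<theta> t = c1 * y t - c2 * x t + c3"
proof -
  let ?g = "\<lambda>t. l\<theta> t + (- c1 * y t + c2 * x t)"
  let ?g' = "\<lambda>t. v t * (lx t * sin (\<theta> t) - ly t * cos (\<theta> t)) +
      ((0 * y t + - c1 * (v t * sin (\<theta> t))) + (0 * x t + c2 * (v t * cos (\<theta> t))))"
  have "ac_primitive 0 T ?g ?g'"
    by (intro ac_primitive_add ac_primitive_mult ac_primitive_const ac)
  moreover have "AE t\<in>{0..T} in lebesgue. ?g' t = 0"
    using lx_eq ly_eq by (intro AE_I2) (auto simp: algebra_simps)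
  ultimately have "?g t = ?g 0"
    using assms times(3) by (rule ac_primitive_zero_imp_const)
  then show ?thesis using constants by (simp add: adjoint_constants_def)
qed

text \<open>The adjoint equation is linear and homogeneous with coefficient
  \<open>v t * cos (\<beta> t)\<close>, bounded by 1. A zero found inside the primitive thus reaches
  time 0, where \<open>c4\<close> is read off.\<close>

lemma l\<beta>_zero:
  assumes "s \<in> {0..T}" "l\<beta> s = 0" "t \<in> {0..T}"
  shows "l\<beta> t = 0"
proof (rule ac_primitive_linear_ode_zero[where f = l\<beta> and c = "\<lambda>t. v t * cos (\<beta> t)", OF _ _ assms])
  show "ac_primitive 0 T l\<beta> (\<lambda>t. (v t * cos (\<beta> t)) * l\<beta> t)"
    using ac(8) by (simp add: mult.commute mult.left_commute)
  show "\<bar>v t * cos (\<beta> t)\<bar> \<le> 1" if "t \<in> {0..T}" for t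
    using v_bound[OF that] by (simp add: abs_mult mult_le_one)
qed

section \<open>The switching functions and their derivatives\<close>

definition \<phi> :: "real \<Rightarrow> real" where
  "\<phi> t = c1 * cos (\<theta> t) + c2 * sin (\<theta> t) - l\<beta> t * sin (\<beta> t)"

text \<open>Up to sign convention, this is the costate paired with the Lie bracket of the driving
  and steering fields; it is minus the rate of change of \<open>\<phi>\<close> when \<theta> and
  \<beta> turn together at unit speed.\<close>

definition \<psi> :: "real \<Rightarrow> real" where
  "\<psi> t = c1 * sin (\<theta> t) - c2 * cos (\<theta> t) + l\<beta> t * cos (\<beta> t)"

lemma phi_v_eq:
  "t \<in> {0..T} \<Longrightarrow> phi_v (x t, y t, \<theta> t, \<beta> t) (lx t, ly t, l\<theta> t, l\<beta> t) = \<phi> t"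
  by (simp add: \<phi>_def lx_eq ly_eq)

lemma v_eq_sgn:
  assumes "t \<in> {0..T}" "\<phi> t \<noteq> 0"
  shows "v t = sgn (\<phi> t)"
proof -
  let ?q = "(x t, y t, \<theta> t, \<beta> t)" and ?l = "(lx t, ly t, l\<theta> t, l\<beta> t)"
  have "v t = sgn (phi_v ?q ?l)"
  proof (rule maximum_condition_v)
    show "hamiltonian ?q ?l z \<le> hamiltonian ?q ?l (v t, \<omega> t)" if "z \<in> control_set" for z
      using extremal assms(1) that unfolding extremal_def by blast
  qed (use assms controls phi_v_eq in auto)
  then show ?thesis using phi_v_eq assms(1) by simp
qed

text \<open>The two contributions of \<open>v\<close>, one from the adjoint equation for
  \<open>l\<beta>\<close> and one from the equation for \<beta>, cancel.\<close>

lemma \<phi>_deriv: "ac_primitive 0 T \<phi> (\<lambda>t. - \<omega> t * \<psi> t)"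
proof -
  let ?f = "\<lambda>t. (c1 * cos (\<theta> t) + c2 * sin (\<theta> t)) + - 1 * (l\<beta> t * sin (\<beta> t))"
  let ?f' = "\<lambda>t. ((0 * cos (\<theta> t) + c1 * (- sin (\<theta> t) * \<omega> t)) + (0 * sin (\<theta> t) + c2 * (cos (\<theta> t) * \<omega> t)))
     + (0 * (l\<beta> t * sin (\<beta> t)) +
        - 1 * (v t * l\<beta> t * cos (\<beta> t) * sin (\<beta> t) + l\<beta> t * (cos (\<beta> t) * (- v t * sin (\<beta> t) + \<omega> t))))"
  have "ac_primitive 0 T ?f ?f'"
    by (intro ac_primitive_add ac_primitive_mult ac_primitive_const ac_primitive_sin ac_primitive_cos ac)
  moreover have "?f = \<phi>" by (simp add: \<phi>_def fun_eq_iff)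
  moreover have "?f' = (\<lambda>t. - \<omega> t * \<psi> t)" by (simp add: \<psi>_def fun_eq_iff algebra_simps)
  ultimately show ?thesis by simp
qed

text \<open>Here the contributions of \<open>v\<close> add up, to \<open>v * l\<beta>\<close> times
  the sum of the squares of \<open>cos \<beta>\<close> and \<open>sin \<beta>\<close>.\<close>

lemma \<psi>_deriv: "ac_primitive 0 T \<psi> (\<lambda>t. \<omega> t * \<phi> t + v t * l\<beta> t)"
proof -
  let ?f = "\<lambda>t. (c1 * sin (\<theta> t) + - c2 * cos (\<theta> t)) + l\<beta> t * cos (\<beta> t)"
  let ?f' = "\<lambda>t. ((0 * sin (\<theta> t) + c1 * (cos (\<theta> t) * \<omega> t)) + (0 * cos (\<theta> t) + - c2 * (- sin (\<theta> t) * \<omega> t)))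
     + (v t * l\<beta> t * cos (\<beta> t) * cos (\<beta> t) + l\<beta> t * (- sin (\<beta> t) * (- v t * sin (\<beta> t) + \<omega> t)))"
  have "ac_primitive 0 T ?f ?f'"
    by (intro ac_primitive_add ac_primitive_mult ac_primitive_const ac_primitive_sin ac_primitive_cos ac)
  moreover have "?f = \<psi>" by (simp add: \<psi>_def fun_eq_iff)
  moreover have "?f' t = \<omega> t * \<phi> t + v t * l\<beta> t" for t
  proof -
    have "?f' t = \<omega> t * \<phi> t + v t * l\<beta> t * (cos (\<beta> t) * cos (\<beta> t) + sin (\<beta> t) * sin (\<beta> t))"
      unfolding \<phi>_def by (simp add: algebra_simps del: sin_cos_squared_add3)
    then show ?thesis by simp
  qed
  ultimately show ?thesis by simp
qed

lemma phi_omega_zero: "t \<in> {t0..t1} \<Longrightarrow> l\<theta> t + l\<beta> t = 0"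
  using singular by (simp add: phi_omega_singular_primitive_def)

lemma v_\<psi>_zero: "AE t\<in>{t0..t1} in lebesgue. v t * \<psi> t = 0"
proof -
  have "ac_primitive 0 T (\<lambda>t. l\<theta> t + l\<beta> t)
     (\<lambda>t. v t * (lx t * sin (\<theta> t) - ly t * cos (\<theta> t)) + v t * l\<beta> t * cos (\<beta> t))"
    by (intro ac_primitive_add ac)
  then have "AE t\<in>{t0..t1} in lebesgue.
      v t * (lx t * sin (\<theta> t) - ly t * cos (\<theta> t)) + v t * l\<beta> t * cos (\<beta> t) = 0"
    by (rule ac_primitive_of_const[OF ac_primitive_subinterval[OF _ times(2)] times(1), where c = 0])
       (rule phi_omega_zero)
  then show ?thesis
    by eventually_elim (use times(2) lx_eq ly_eq in \<open>auto simp: \<psi>_def algebra_simps subset_iff\<close>)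
qed

text \<open>Where \<open>\<phi> \<noteq> 0\<close> one has \<open>v = \<plusminus>1\<close>, so the two identities \<open>(\<phi>\<^sup>2)' = -2 \<omega> \<psi> \<phi>\<close> and
  \<open>v \<psi> = 0\<close> make \<open>\<phi>\<^sup>2\<close> constant without assuming in advance that \<open>\<phi>\<close> has no zero.\<close>
lemma \<phi>_nonzero:
  assumes t: "t \<in> {t0..t1}"
  shows "\<phi> t \<noteq> 0"
proof -
  have *: "ac_primitive t0 t1 (\<lambda>t. \<phi> t * \<phi> t) (\<lambda>t. - \<omega> t * \<psi> t * \<phi> t + \<phi> t * (- \<omega> t * \<psi> t))"
    by (intro ac_primitive_mult ac_primitive_subinterval[OF \<phi>_deriv times(2)])
  have "AE t\<in>{t0..t1} in lebesgue. - \<omega> t * \<psi> t * \<phi> t + \<phi> t * (- \<omega> t * \<psi> t) = 0"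
    using v_\<psi>_zero
  proof eventually_elim
    case (elim t)
    show ?case
    proof
      assume t: "t \<in> {t0..t1}"
      then have "v t \<noteq> 0" if "\<phi> t \<noteq> 0"
        using v_eq_sgn[of t] times(2) that by (auto simp: sgn_eq_0_iff)
      then have "\<psi> t * \<phi> t = 0" using elim t by auto
      then show "- \<omega> t * \<psi> t * \<phi> t + \<phi> t * (- \<omega> t * \<psi> t) = 0" by auto
    qed
  qed
  from ac_primitive_zero_imp_const[OF * this t] have "\<phi> t * \<phi> t = \<phi> s * \<phi> s" if "s \<in> {t0..t1}" for s
    using that by blast
  \<comment> \<open>Since \<open>phi_omega\<close> vanishes along the primitive, excluding that both
    switching functions vanish identically leaves a time with nonzero \<open>phi_v\<close>.\<close>
  moreover have "\<exists>s\<in>{t0..t1}. phi_v (x s, y s, \<theta> s, \<beta> s) (lx s, ly s, l\<theta> s, l\<beta> s) \<noteq> 0"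
    using singular by (simp add: phi_omega_singular_primitive_def del: phi_v.simps) metis
  then obtain s where "s \<in> {t0..t1}" "\<phi> s \<noteq> 0"
    using phi_v_eq times(2) by (metis subsetD)
  ultimately show ?thesis by fastforce
qed

lemma \<psi>_zero_AE: "AE t\<in>{t0..t1} in lebesgue. \<psi> t = 0"
  using v_\<psi>_zero
proof eventually_elim
  case (elim t)
  then show ?case
    using v_eq_sgn[of t] times(2) \<phi>_nonzero[of t] by (auto simp: sgn_eq_0_iff)
qed

text \<open>The square of \<psi> has a derivative with factor \<psi>, which is zero almost
  everywhere, so it is constant; its constant value is zero because \<psi> vanishes
  somewhere.\<close>

lemma \<psi>_zero:
  assumes "t \<in> {t0..t1}"
  shows "\<psi> t = 0"
proof -
  have *: "ac_primitive t0 t1 (\<lambda>t. \<psi> t * \<psi> t)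
     (\<lambda>t. (\<omega> t * \<phi> t + v t * l\<beta> t) * \<psi> t + \<psi> t * (\<omega> t * \<phi> t + v t * l\<beta> t))"
    by (intro ac_primitive_mult ac_primitive_subinterval[OF \<psi>_deriv times(2)])
  have "AE t\<in>{t0..t1} in lebesgue.
      (\<omega> t * \<phi> t + v t * l\<beta> t) * \<psi> t + \<psi> t * (\<omega> t * \<phi> t + v t * l\<beta> t) = 0"
    using \<psi>_zero_AE by eventually_elim auto
  note const = ac_primitive_zero_imp_const[OF * this assms]
  obtain s where "s \<in> {t0..t1}" "\<psi> s = 0"
    using AE_interval_imp_ex[OF \<psi>_zero_AE times(1)] by metis
  with const[of s] show ?thesis by simp
qed

text \<open>Constancy fixes one sign of \<phi>, hence one driving direction and one orientation
  along the line, for the whole primitive.\<close>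

lemma \<phi>_const:
  assumes "t \<in> {t0..t1}"
  shows "\<phi> t = \<phi> t0"
proof (rule ac_primitive_zero_imp_const[OF ac_primitive_subinterval[OF \<phi>_deriv times(2)] _ assms])
  show "AE t\<in>{t0..t1} in lebesgue. - \<omega> t * \<psi> t = 0"
    using \<psi>_zero_AE by eventually_elim auto
qed (use times(1) in auto)

text \<open>Differentiating the identity \<open>\<psi> = 0\<close> gives the singular control: with
  \<open>v = sgn \<phi>\<close> and \<open>l\<theta> = - l\<beta>\<close> it reads
  \<open>\<omega> = l\<theta> / \<bar>\<phi>\<bar>\<close>.\<close>

lemma singular_steering: "AE t\<in>{t0..t1} in lebesgue. \<omega> t * \<phi> t + v t * l\<beta> t = 0"
  by (rule ac_primitive_of_const[OF ac_primitive_subinterval[OF \<psi>_deriv times(2)] times(1) \<psi>_zero])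

text \<open>On the segment the singular steering relation reduces to
  \<open>v t * l\<beta> t = 0\<close> with \<open>v t\<close> nonzero. One such time suffices, and
  positive length provides it.\<close>

lemma l\<beta>_zero_of_straight_segment:
  assumes "{a..b} \<subseteq> {t0..t1}" "straight_segment v \<omega> a b" "t \<in> {0..T}"
  shows "l\<beta> t = 0"
proof -
  obtain s where "s \<in> {1, -1}" "AE t\<in>{a..b} in lebesgue. v t = s \<and> \<omega> t = 0" and "a < b"
    using assms(2) unfolding straight_segment_def by blast
  then have "AE t\<in>{a..b} in lebesgue. v t \<noteq> 0 \<and> \<omega> t = 0"
    by (auto elim!: eventually_mono)
  with singular_steering have "AE t\<in>{a..b} in lebesgue. l\<beta> t = 0"
    by eventually_elim (use assms(1) in auto)
  from AE_interval_imp_ex[OF this \<open>a < b\<close>] obtain r where "r \<in> {a..b}" "l\<beta> r = 0"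
    by blast
  then show ?thesis
    using l\<beta>_zero assms(1,3) times(2) by blast
qed

section \<open>Shape of the primitive when \<open>l\<beta>\<close> vanishes on it\<close>

lemma \<omega>_zero_of_l\<beta>_zero:
  assumes "\<And>t. t \<in> {t0..t1} \<Longrightarrow> l\<beta> t = 0"
  shows "AE t\<in>{t0..t1} in lebesgue. \<omega> t = 0"
  using singular_steering by eventually_elim (use assms \<phi>_nonzero in auto)

lemma \<theta>_const_of_l\<beta>_zero:
  assumes "\<And>t. t \<in> {t0..t1} \<Longrightarrow> l\<beta> t = 0" "t \<in> {t0..t1}"
  shows "\<theta> t = \<theta> t0"
proof (rule ac_primitive_zero_imp_const[OF ac_primitive_subinterval[OF ac(3) times(2)]])
  show "AE t\<in>{t0..t1} in lebesgue. \<omega> t = 0"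
    using assms(1) by (rule \<omega>_zero_of_l\<beta>_zero)
qed (use assms(2) times(1) in auto)

text \<open>The pointwise half concerns times that a null set could hide. There the constancy of
  \<theta> gives derivative 0, and uniqueness of the derivative identifies it with
  \<open>\<omega> t\<close>.\<close>

lemma steering_zero_of_l\<beta>_zero:
  assumes "\<And>t. t \<in> {t0..t1} \<Longrightarrow> l\<beta> t = 0"
  shows "steering_equals \<theta> \<omega> t0 t1 (\<lambda>t. 0)"
  unfolding steering_equals_def
proof (intro conjI ballI impI)
  show "AE t\<in>{t0..t1} in lebesgue. \<omega> t = 0"
    using assms by (rule \<omega>_zero_of_l\<beta>_zero)
  fix t assume t: "t \<in> {t0..t1}" and deriv: "(\<theta> has_real_derivative \<omega> t) (at t within {t0..t1})"
  have "((\<lambda>t. \<theta> t0) has_real_derivative 0) (at t within {t0..t1})" by simp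
  then have "(\<theta> has_real_derivative 0) (at t within {t0..t1})"
    by (rule has_field_derivative_transform_within[OF _ zero_less_one t])
       (rule \<theta>_const_of_l\<beta>_zero[symmetric, OF assms])
  then show "\<omega> t = 0"
    using has_real_derivative_within_interval_unique[OF times(1) t deriv] by blast
qed

lemma straight_segment_of_l\<beta>_zero:
  assumes "\<And>t. t \<in> {t0..t1} \<Longrightarrow> l\<beta> t = 0"
  shows "straight_segment v \<omega> t0 t1"
proof -
  have "v t = sgn (\<phi> t0)" if "t \<in> {t0..t1}" for t
    using v_eq_sgn[of t] \<phi>_nonzero[OF that] \<phi>_const[OF that] times(2) that by auto
  then have "AE t\<in>{t0..t1} in lebesgue. v t = sgn (\<phi> t0) \<and> \<omega> t = 0"
    using \<omega>_zero_of_l\<beta>_zero[OF assms] by (auto elim!: eventually_mono)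
  moreover have "sgn (\<phi> t0) \<in> {1, -1}"
    using \<phi>_nonzero[of t0] times(1) by (auto simp: sgn_if)
  ultimately show ?thesis
    using times(1) unfolding straight_segment_def by blast
qed

text \<open>In polar coordinates for \<open>(c1, c2)\<close>, \<phi> and \<psi> become
  \<open>r\<close> times the cosine and the sine of the line angle. The sine vanishes, and the sign
  of the constant \<phi> selects the same angle at all times.\<close>

lemma line_angle_of_l\<beta>_zero:
  assumes "\<And>t. t \<in> {t0..t1} \<Longrightarrow> l\<beta> t = 0" and t: "t \<in> {t0..t1}"
  shows "[line_angle c1 c2 (\<theta> t) = (if \<phi> t0 > 0 then 0 else pi)] (rmod (2 * pi))"
proof -
  define r A where "r = cmod (Complex c1 c2)" and "A = Arg (Complex c1 c2)"
  have "rcis r A = Complex c1 c2" unfolding r_def A_def by (rule rcis_cmod_Arg)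
  then have c: "c1 = r * cos A" "c2 = r * sin A"
    by (simp_all add: complex_eq_iff)
  have "\<phi> t0 = c1 * cos (\<theta> t) + c2 * sin (\<theta> t)"
    using \<phi>_const[OF t] assms by (simp add: \<phi>_def)
  then have cos: "\<phi> t0 = r * cos (\<theta> t - A)"
    by (simp add: c cos_diff algebra_simps)
  have "0 = c1 * sin (\<theta> t) - c2 * cos (\<theta> t)"
    using \<psi>_zero[OF t] assms by (simp add: \<psi>_def)
  then have sin: "0 = r * sin (\<theta> t - A)"
    by (simp add: c sin_diff algebra_simps)
  have "\<phi> t0 \<noteq> 0" using \<phi>_nonzero[of t0] times(1) by simp
  then have "r > 0" using cos unfolding r_def by (metis mult_zero_left norm_ge_zero order_le_less)
  then have "sin (\<theta> t - A) = 0" using sin by simp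
  moreover from this have "cos (\<theta> t - A) = (if \<phi> t0 > 0 then 1 else - 1)"
    using cos \<open>r > 0\<close> sin_zero_abs_cos_one[of "\<theta> t - A"]
    by (auto simp: abs_if zero_less_mult_iff split: if_splits)
  \<comment> \<open>Equality of \<open>cis\<close> values is exactly congruence of the angles modulo
    \<open>2 * pi\<close>.\<close>
  ultimately have "cis (\<theta> t - A) = cis (if \<phi> t0 > 0 then 0 else pi)"
    by (simp add: complex_eq_iff)
  then show ?thesis
    unfolding line_angle_def A_def cis_eq_iff .
qed

end

theorem lemma5p2:
  fixes T t0 t1 c1 c2 c3 c4 :: real
    and x y \<theta> \<beta> v \<omega> l\<^sub>x l\<^sub>y l\<^sub>\<theta> l\<^sub>\<beta> :: "real \<Rightarrow> real"
  defines "\<alpha> \<equiv> \<lambda>t. line_angle c1 c2 (\<theta> t)"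
    and "d \<equiv> \<lambda>t. signed_dist c1 c2 c3 (x t, y t)"
  assumes "extremal T x y \<theta> \<beta> v \<omega> l\<^sub>x l\<^sub>y l\<^sub>\<theta> l\<^sub>\<beta>"
    and "adjoint_constants x y l\<^sub>x l\<^sub>y l\<^sub>\<theta> l\<^sub>\<beta> c1 c2 c3 c4"
    and "phi_omega_singular_primitive T (\<lambda>t. (x t, y t, \<theta> t, \<beta> t))
           (\<lambda>t. (l\<^sub>x t, l\<^sub>y t, l\<^sub>\<theta> t, l\<^sub>\<beta> t)) t0 t1"
    and "\<exists>a b. {a..b} \<subseteq> {t0..t1} \<and> straight_segment v \<omega> a b"
  shows "(c1, c2) \<noteq> (0, 0) \<and>
         (\<forall>a b. {a..b} \<subseteq> {t0..t1} \<and> straight_segment v \<omega> a b \<longrightarrow>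
           (\<forall>t\<in>{a..b}. (x t, y t) \<in> ell c1 c2 c3)) \<and>
         (c4 = 0 \<and> straight_segment v \<omega> t0 t1 \<and>
           ((\<forall>t\<in>{t0..t1}. [\<alpha> t = 0] (rmod (2 * pi))) \<or>
            (\<forall>t\<in>{t0..t1}. [\<alpha> t = pi] (rmod (2 * pi)))) \<and>
           steering_equals \<theta> \<omega> t0 t1 (\<lambda>t. 0) \<and>
           (\<forall>t\<in>{t0..t1}. l\<^sub>\<beta> t = 0 \<and> l\<^sub>\<theta> t = 0)
         \<or>
         steering_equals \<theta> \<omega> t0 t1 d \<and>
         (\<forall>t\<in>{t0..t1}.
           ([\<alpha> t = 2 * \<beta> t] (rmod (2 * pi)) \<or> [\<alpha> t = - (2 * \<beta> t)] (rmod (2 * pi))) \<and>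
           (d t = 2 * sin (\<beta> t) \<or> d t = - (2 * sin (\<beta> t))) \<and>
           (angle_between (- pi / 6) (pi / 6) (\<beta> t) \<or>
            angle_between (5 * pi / 6) (7 * pi / 6) (\<beta> t))))"
proof -
  interpret singular_primitive T t0 t1 c1 c2 c3 c4 x y \<theta> \<beta> v \<omega> l\<^sub>x l\<^sub>y l\<^sub>\<theta> l\<^sub>\<beta>
    using assms(3-5) by unfold_locales
  have l\<beta>_0: "l\<^sub>\<beta> t = 0" if "t \<in> {0..T}" for t
    using assms(6) l\<beta>_zero_of_straight_segment that by blast
  then have l\<beta>: "l\<^sub>\<beta> t = 0" if "t \<in> {t0..t1}" for t
    using that times(2) by blast
  then have l\<theta>: "l\<^sub>\<theta> t = 0" if "t \<in> {t0..t1}" for t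
    using phi_omega_zero that by fastforce
  \<comment> \<open>The affine form defining \<open>ell\<close> equals
    \<open>l\<^sub>\<theta>\<close> along the extremal, so its vanishing places the robot on the
    line.\<close>
  have on_ell: "(x t, y t) \<in> ell c1 c2 c3" if "t \<in> {t0..t1}" for t
    using l\<theta>_eq[of t] l\<theta>[OF that] that times(2) by (auto simp: ell_def)
  have "c4 = 0"
    using l\<beta>_0[OF times(3)] constants by (simp add: adjoint_constants_def)
  \<comment> \<open>With \<open>l\<^sub>\<beta> t0 = 0\<close> the nonzero number
    \<open>\<phi> t0\<close> is a linear combination of \<open>c1\<close> and
    \<open>c2\<close>.\<close>
  moreover have "(c1, c2) \<noteq> (0, 0)"
    using \<phi>_nonzero[of t0] l\<beta>[of t0] times(1) by (auto simp: \<phi>_def)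
  moreover have "\<forall>a b. {a..b} \<subseteq> {t0..t1} \<and> straight_segment v \<omega> a b \<longrightarrow>
      (\<forall>t\<in>{a..b}. (x t, y t) \<in> ell c1 c2 c3)"
    using on_ell by blast
  moreover have "(\<forall>t\<in>{t0..t1}. [\<alpha> t = 0] (rmod (2 * pi))) \<or> (\<forall>t\<in>{t0..t1}. [\<alpha> t = pi] (rmod (2 * pi)))"
    using line_angle_of_l\<beta>_zero[OF l\<beta>] unfolding \<alpha>_def by (cases "\<phi> t0 > 0") auto
  moreover have "straight_segment v \<omega> t0 t1" "steering_equals \<theta> \<omega> t0 t1 (\<lambda>t. 0)"
    by (intro straight_segment_of_l\<beta>_zero steering_zero_of_l\<beta>_zero l\<beta>; assumption)+
  moreover have "\<forall>t\<in>{t0..t1}. l\<^sub>\<beta> t = 0 \<and> l\<^sub>\<theta> t = 0"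
    using l\<beta> l\<theta> by blast
  ultimately show ?thesis
    by blast
qed

end
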